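(* Let $\sigma\subseteq\tau$ be topologies on a set $X$ with $\tau$ semiregular. Let $\kappa$ be an infinite cardinal such that $\tau$ is $\kappa$-Baire, and let $1\leq\alpha\leq\kappa$ be an ordinal. Assume that $\tau$ has a neighborhood basis consisting of sets in $\bigcup_{\xi<\alpha}\mathbf{\Pi}^{\kappa,0}_{1+\xi}$ with respect to $\sigma$. Then $\tau=(\sigma,\tau)_\alpha$.
   Context: All topologies are on a fixed set $X$; $\mathrm{int}_\tau$ denotes interior with respect to $\tau$. The topologies $(\sigma,\tau)_\xi$: for topologies $\sigma\subseteq\tau$, define by recursion on ordinals $(\sigma,\tau)_0=\sigma$ and, for $\xi>0$, $(\sigma,\tau)_\xi$ is the family of all unions of sets of the form $U\cap\mathrm{int}_\tau(F)$ where, for some $\gamma<\xi$, $U$ is $(\sigma,\tau)_\gamma$-open and $F$ is $(\sigma,\tau)_\gamma$-closed. (Each $(\sigma,\tau)_\xi$ is a topology.) Neighborhood basis of $\tau$: a family $\mathcal{A}$ of subsets of $X$ (not necessarily open) such that for each $x\in X$ and each $\tau$-open $B\ni x$ there is $A\in\mathcal{A}$ with $x\in\mathrm{int}_\tau(A)$ and $A\subseteq B$. $\kappa$-Baire: a set is $\kappa$-meager (with respect to $\tau$) if it is the union of $<\kappa$ many $\tau$-nowhere dense sets; $\tau$ is $\kappa$-Baire if the complement of each $\kappa$-meager set is $\tau$-dense. Semiregular: a topology is semiregular if it is generated by its regular open sets, i.e. sets equal to the interior of their closure (equivalently, each open set is a union of interiors of closed sets). Borel classes (with respect to a given topology): for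 a cardinal $\nu>0$ (possibly finite) with cardinal successor $\nu^+$, let $\mathbf{P}^\nu_0$ be the family of all closed sets and, for $0<\xi<\nu^+$, let $\mathbf{P}^\nu_\xi$ consist of intersections of subfamilies of cardinality $\leq\nu$ of complements of sets in $\bigcup_{\gamma<\xi}\mathbf{P}^\nu_\gamma$. For an ordinal $\xi<\kappa$, $\mathbf{\Pi}^{\kappa,0}_{1+\xi}=\bigcup\{\mathbf{P}^\nu_\xi\mid\nu\text{ a cardinal},\ \nu<\kappa,\ \xi<\nu^+\}$. "With respect to $\sigma$" means these are computed starting from the $\sigma$-closed sets. *)

theory Defs
  imports "HOL-Analysis.Analysis"
begin

unbundle cardinal_syntax

text \<open>
  Ordinals are represented by well-order relations and cardinals by relations satisfying
  \<^term>\<open>Card_order\<close>; comparison is by \<^term>\<open>(<o)\<close> and \<^term>\<open>(\<le>o)\<close>, which are invariant under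
  order isomorphism.  The empty relation is the ordinal (and cardinal) zero.  If
  \<^term>\<open>\<xi> :: 'o rel\<close> is an ordinal then each smaller ordinal is the order type of a proper
  initial segment of \<^term>\<open>\<xi>\<close>, hence is represented by a relation of the same type
  \<^typ>\<open>'o rel\<close>; quantifying over relations \<^term>\<open>\<gamma> :: 'o rel\<close> with \<^term>\<open>\<gamma> <o \<xi>\<close>
  therefore ranges over all ordinals below \<^term>\<open>\<xi>\<close>.  The same applies to the cardinals below a
  given cardinal.
\<close>

subsection \<open>The topologies interpolating between two topologies\<close>

function interp_open :: "'a topology \<Rightarrow> 'a topology \<Rightarrow> 'o rel \<Rightarrow> 'a set set" where
  "interp_open \<sigma> \<tau> \<xi> =
     (if \<xi> = {} then {U. openin \<sigma> U}
      else {\<Union>\<V> |\<V>. \<V> \<subseteq>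
        (\<Union>\<gamma>\<in>{\<gamma>. \<gamma> <o \<xi>}. {U \<inter> \<tau> interior_of F |U F.
           U \<in> interp_open \<sigma> \<tau> \<gamma> \<and>
           F \<subseteq> topspace \<tau> \<and> topspace \<tau> - F \<in> interp_open \<sigma> \<tau> \<gamma>})})"
  by pat_completeness auto
termination
  by (relation "inv_image ordLess (\<lambda>(_, _, \<xi>). \<xi>)") (auto simp: wf_ordLess)

declare interp_open.simps [simp del]

definition interp_topology :: "'a topology \<Rightarrow> 'a topology \<Rightarrow> 'o rel \<Rightarrow> 'a topology" where
  "interp_topology \<sigma> \<tau> \<xi> = topology (\<lambda>U. U \<in> interp_open \<sigma> \<tau> \<xi>)"

text \<open>
  The following lemmas justify the use of \<^term>\<open>topology\<close> above: \<^term>\<open>interp_open \<sigma> \<tau> \<xi>\<close>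
  is the family of open sets of \<^term>\<open>interp_topology \<sigma> \<tau> \<xi>\<close>.
\<close>

lemma ordLess_nonempty:
  assumes "\<gamma> <o \<xi>"
  shows "\<xi> \<noteq> {}"
proof
  assume "\<xi> = {}"
  with assms obtain f where f: "embedS \<gamma> \<xi> f" and "\<xi> = {}"
    unfolding ordLess_def by blast
  then have f: "embed \<gamma> {} f" "\<not> bij_betw f (Field \<gamma>) {}"
    by (simp_all add: embedS_def)
  from embed_Field[OF f(1)] have "Field \<gamma> = {}" by simp
  with f(2) show False by (simp add: bij_betw_def)
qed

definition interp_basic :: "'a topology \<Rightarrow> 'a topology \<Rightarrow> 'o rel \<Rightarrow> 'a set \<Rightarrow> bool" where
  "interp_basic \<sigma> \<tau> \<xi> V \<longleftrightarrow>
     V \<in> (\<Union>\<gamma>\<in>{\<gamma> :: 'o rel. \<gamma> <o \<xi>}. {U \<inter> \<tau> interior_of F |U F.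
           U \<in> interp_open \<sigma> \<tau> \<gamma> \<and>
           F \<subseteq> topspace \<tau> \<and> topspace \<tau> - F \<in> interp_open \<sigma> \<tau> \<gamma>})"

lemma interp_basicI:
  fixes \<gamma> \<xi> :: "'o rel"
  shows "\<lbrakk>\<gamma> <o \<xi>; U \<in> interp_open \<sigma> \<tau> \<gamma>; F \<subseteq> topspace \<tau>; topspace \<tau> - F \<in> interp_open \<sigma> \<tau> \<gamma>\<rbrakk>
    \<Longrightarrow> interp_basic \<sigma> \<tau> \<xi> (U \<inter> \<tau> interior_of F)"
  unfolding interp_basic_def by blast

lemma interp_open_nonempty:
  fixes \<xi> :: "'o rel"
  assumes "\<xi> \<noteq> {}"
  shows "U \<in> interp_open \<sigma> \<tau> \<xi> \<longleftrightarrow> (arbitrary union_of interp_basic \<sigma> \<tau> \<xi>) U"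
proof -
  have "Collect (interp_basic \<sigma> \<tau> \<xi>) = (\<Union>\<gamma>\<in>{\<gamma> :: 'o rel. \<gamma> <o \<xi>}. {U \<inter> \<tau> interior_of F |U F.
           U \<in> interp_open \<sigma> \<tau> \<gamma> \<and>
           F \<subseteq> topspace \<tau> \<and> topspace \<tau> - F \<in> interp_open \<sigma> \<tau> \<gamma>})"
    unfolding interp_basic_def by blast
  then have "interp_open \<sigma> \<tau> \<xi> = {\<Union>\<V> |\<V>. \<V> \<subseteq> Collect (interp_basic \<sigma> \<tau> \<xi>)}"
    using assms by (subst interp_open.simps) (simp only: if_False)
  then show ?thesis
    unfolding union_of_def arbitrary_def by blast
qed

lemma interp_open_subset:
  assumes "topspace \<sigma> = topspace \<tau>" "U \<in> interp_open \<sigma> \<tau> \<xi>"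
  shows "U \<subseteq> topspace \<tau>"
proof (cases "\<xi> = {}")
  case True
  with assms show ?thesis by (metis interp_open.simps mem_Collect_eq openin_subset)
next
  case False
  with assms show ?thesis
    using interior_of_subset_topspace[of \<tau>]
    unfolding interp_open_nonempty[OF False] union_of_def interp_basic_def by blast
qed

lemma empty_in_interp_open: "{} \<in> interp_open \<sigma> \<tau> \<xi>"
proof (cases "\<xi> = {}")
  case True
  then show ?thesis by (subst interp_open.simps) simp
next
  case False
  then show ?thesis
    unfolding interp_open_nonempty[OF False] union_of_def arbitrary_def by blast
qed

lemma interp_open_mono:
  fixes \<gamma> \<xi> :: "'o rel"
  assumes "topspace \<sigma> = topspace \<tau>" "\<gamma> <o \<xi>"
  shows "interp_open \<sigma> \<tau> \<gamma> \<subseteq> interp_open \<sigma> \<tau> \<xi>"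
proof
  fix U assume U: "U \<in> interp_open \<sigma> \<tau> \<gamma>"
  have *: "U \<inter> \<tau> interior_of topspace \<tau> = U"
    using interp_open_subset[OF assms(1) U] by auto
  have "interp_basic \<sigma> \<tau> \<xi> (U \<inter> \<tau> interior_of topspace \<tau>)"
    using assms(2) U by (rule interp_basicI) (simp_all add: empty_in_interp_open)
  then show "U \<in> interp_open \<sigma> \<tau> \<xi>"
    unfolding interp_open_nonempty[OF ordLess_nonempty[OF assms(2)]] *
    by (rule arbitrary_union_of_inc)
qed

lemma interp_open_ordIso:
  fixes \<gamma> \<xi> :: "'o rel"
  assumes "\<gamma> =o \<xi>"
  shows "interp_open \<sigma> \<tau> \<gamma> = interp_open \<sigma> \<tau> \<xi>"
proof -
  have "\<delta> <o \<gamma> \<longleftrightarrow> \<delta> <o \<xi>" for \<delta> :: "'o rel"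
    using assms ordIso_symmetric ordLess_ordIso_trans by blast
  moreover have "\<gamma> = {} \<longleftrightarrow> \<xi> = {}"
  proof -
    obtain f where "bij_betw f (Field \<gamma>) (Field \<xi>)"
      using assms by (auto simp: ordIso_def iso_def)
    then have "Field \<gamma> = {} \<longleftrightarrow> Field \<xi> = {}"
      by (auto simp: bij_betw_def)
    then show ?thesis
      by (auto simp: Field_def Domain_empty_iff)
  qed
  ultimately show ?thesis
    using interp_open.simps[of \<sigma> \<tau> \<gamma>] interp_open.simps[of \<sigma> \<tau> \<xi>] by simp
qed

lemma istopology_interp_open:
  fixes \<xi> :: "'o rel"
  assumes "topspace \<sigma> = topspace \<tau>"
  shows "istopology (\<lambda>U. U \<in> interp_open \<sigma> \<tau> \<xi>)"
  using wf_ordLess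
proof (induction \<xi> rule: wf_induct_rule)
  case (less \<xi>)
  let ?G = "interp_open \<sigma> \<tau> :: 'o rel \<Rightarrow> _"
  let ?X = "topspace \<tau>"
  show ?case
  proof (cases "\<xi> = {}")
    case True
    then show ?thesis by (simp add: interp_open.simps[of _ _ "{}"])
  next
    case False
    show ?thesis
      unfolding interp_open_nonempty[OF False]
    proof (rule istopology_base)
      fix S T assume "interp_basic \<sigma> \<tau> \<xi> S" "interp_basic \<sigma> \<tau> \<xi> T"
      then obtain \<gamma> U F \<gamma>' U' F' where
        S: "S = U \<inter> \<tau> interior_of F" "\<gamma> <o \<xi>" "U \<in> ?G \<gamma>" "F \<subseteq> ?X" "?X - F \<in> ?G \<gamma>" and
        T: "T = U' \<inter> \<tau> interior_of F'" "\<gamma>' <o \<xi>" "U' \<in> ?G \<gamma>'" "F' \<subseteq> ?X" "?X - F' \<in> ?G \<gamma>'"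
        unfolding interp_basic_def by blast
      have "Well_order \<gamma>" "Well_order \<gamma>'"
        using S(2) T(2) unfolding ordLess_def by blast+
      then have "\<gamma> <o \<gamma>' \<or> \<gamma>' <o \<gamma> \<or> \<gamma> =o \<gamma>'"
        using ordLess_or_ordLeq[of \<gamma> \<gamma>'] ordIso_symmetric[of \<gamma>' \<gamma>]
        unfolding ordLeq_iff_ordLess_or_ordIso by blast
      then obtain \<delta> where d: "\<delta> <o \<xi>" "?G \<gamma> \<subseteq> ?G \<delta>" "?G \<gamma>' \<subseteq> ?G \<delta>"
        using S(2) T(2) interp_open_mono[OF assms] interp_open_ordIso by blast
      have top: "istopology (\<lambda>U. U \<in> ?G \<delta>)"
        using less.IH d(1) .
      have "U \<inter> U' \<in> ?G \<delta>"
        using top d S(3) T(3) unfolding istopology_def by blast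
      moreover have "\<Union>{?X - F, ?X - F'} \<in> ?G \<delta>"
      proof -
        have "\<forall>K\<in>{?X - F, ?X - F'}. K \<in> ?G \<delta>"
          using d S(5) T(5) by blast
        then show ?thesis
          using top unfolding istopology_def by blast
      qed
      moreover have "\<Union>{?X - F, ?X - F'} = ?X - F \<inter> F'"
        by blast
      ultimately have "interp_basic \<sigma> \<tau> \<xi> ((U \<inter> U') \<inter> \<tau> interior_of (F \<inter> F'))"
        using d(1) S(4) by (intro interp_basicI[of \<delta>]) auto
      moreover have "S \<inter> T = (U \<inter> U') \<inter> \<tau> interior_of (F \<inter> F')"
        unfolding S(1) T(1) interior_of_Int by blast
      ultimately show "interp_basic \<sigma> \<tau> \<xi> (S \<inter> T)"
        by simp
    qed
  qed
qed

lemma openin_interp_topology: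
  assumes "topspace \<sigma> = topspace \<tau>"
  shows "openin (interp_topology \<sigma> \<tau> \<xi>) U \<longleftrightarrow> U \<in> interp_open \<sigma> \<tau> \<xi>"
  unfolding interp_topology_def 
  by (subst topology_inverse'[OF istopology_interp_open[OF assms]]) (rule refl)


subsection \<open>Borel classes\<close>

text \<open>
  Intersections are formed inside the underlying set, so that the intersection of the empty
  family is the whole space.
\<close>

function borel_P :: "'a topology \<Rightarrow> 'n rel \<Rightarrow> 'o rel \<Rightarrow> 'a set set" where
  "borel_P \<sigma> \<nu> \<xi> =
     (if \<xi> = {} then {C. closedin \<sigma> C}
      else {topspace \<sigma> \<inter> \<Inter>\<F> |\<F>. |\<F>| \<le>o \<nu> \<and>
        \<F> \<subseteq> (\<lambda>A. topspace \<sigma> - A) ` (\<Union>\<gamma>\<in>{\<gamma>. \<gamma> <o \<xi>}. borel_P \<sigma> \<nu> \<gamma>)})"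
  by pat_completeness auto
termination
  by (relation "inv_image ordLess (\<lambda>(_, _, \<xi>). \<xi>)") (auto simp: wf_ordLess)

declare borel_P.simps [simp del]

text \<open>
  \<^term>\<open>borel_Pi \<sigma> \<kappa> \<xi>\<close> is the class usually indexed by $1 + \xi$.  Finite \<^term>\<open>\<nu>\<close> are
  allowed; for them \<^term>\<open>cardSuc \<nu>\<close> is the next natural number.
\<close>

definition borel_Pi :: "'a topology \<Rightarrow> 'k rel \<Rightarrow> 'o rel \<Rightarrow> 'a set set" where
  "borel_Pi \<sigma> \<kappa> \<xi> =
     \<Union>{borel_P \<sigma> \<nu> \<xi> |\<nu> :: 'k rel. Card_order \<nu> \<and> \<nu> \<noteq> {} \<and> \<nu> <o \<kappa> \<and> \<xi> <o cardSuc \<nu>}"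

subsection \<open>Topological notions\<close>

definition nhd_basis :: "'a topology \<Rightarrow> 'a set set \<Rightarrow> bool" where
  "nhd_basis \<tau> \<A> \<longleftrightarrow>
     (\<forall>A\<in>\<A>. A \<subseteq> topspace \<tau>) \<and>
     (\<forall>x B. openin \<tau> B \<longrightarrow> x \<in> B \<longrightarrow> (\<exists>A\<in>\<A>. x \<in> \<tau> interior_of A \<and> A \<subseteq> B))"

definition nowhere_dense_in :: "'a topology \<Rightarrow> 'a set \<Rightarrow> bool" where
  "nowhere_dense_in \<tau> N \<longleftrightarrow> N \<subseteq> topspace \<tau> \<and> \<tau> interior_of (\<tau> closure_of N) = {}"

definition kappa_meager :: "'k rel \<Rightarrow> 'a topology \<Rightarrow> 'a set \<Rightarrow> bool" where
  "kappa_meager \<kappa> \<tau> M \<longleftrightarrow> (\<exists>\<N>. |\<N>| <o \<kappa> \<and> (\<forall>N\<in>\<N>. nowhere_dense_in \<tau> N) \<and> M = \<Union>\<N>)"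

definition kappa_Baire :: "'k rel \<Rightarrow> 'a topology \<Rightarrow> bool" where
  "kappa_Baire \<kappa> \<tau> \<longleftrightarrow>
     (\<forall>M. kappa_meager \<kappa> \<tau> M \<longrightarrow> \<tau> closure_of (topspace \<tau> - M) = topspace \<tau>)"

definition regular_openin :: "'a topology \<Rightarrow> 'a set \<Rightarrow> bool" where
  "regular_openin \<tau> U \<longleftrightarrow> \<tau> interior_of (\<tau> closure_of U) = U"

definition semiregular :: "'a topology \<Rightarrow> bool" where
  "semiregular \<tau> \<longleftrightarrow> topology_generated_by {U. regular_openin \<tau> U} = \<tau>"

end

theory Submission
  imports Defs
begin

text \<open>
  Call two sets equal modulo meager sets if their symmetric difference is covered by few
  \<open>\<tau>\<close>-nowhere dense sets.  As in the classical proof that Borel sets have the Baire property, a set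
  \<open>A\<close> of class \<open>\<Pi>\<^bsub>1+\<xi>\<^esub>\<close> with respect to \<open>\<sigma>\<close> is equal, modulo meager sets, to a closed set \<open>F\<close>; the
  point is that \<open>F\<close> may be taken closed in \<open>(\<sigma>,\<tau>)\<^bsub>\<xi>\<^esub>\<close> and not just in \<open>\<tau>\<close>
  (\<open>borel_P_eq_interp_closed_mod_meager\<close>).  Indeed, if the complement of \<open>A\<close> is the union of simpler
  sets \<open>B\<^sub>i\<close>, with closed approximations \<open>F\<^sub>i\<close>, then each \<open>F\<^sub>i\<close> differs from its \<open>\<tau>\<close>-interior by its
  nowhere dense boundary only, and the \<open>\<tau>\<close>-interior of a \<open>(\<sigma>,\<tau>)\<^bsub>\<gamma>\<^esub>\<close>-closed set is, by the very
  definition, open in every later topology \<open>(\<sigma>,\<tau>)\<^bsub>\<xi>\<^esub>\<close>.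

  When \<open>\<tau>\<close> is \<open>\<kappa>\<close>-Baire, no nonempty open set is meager, so equality modulo meager sets gives
  \<open>int A \<subseteq> int F \<subseteq> int (cl A)\<close> (\<open>interior_between_if_eq_mod_meager\<close>).  Given a point of a \<open>\<tau>\<close>-open set,
  semiregularity provides a regular open \<open>R\<close> between them, and the neighborhood basis a set \<open>A \<subseteq> R\<close>
  whose interior contains the point.  Then \<open>int F \<subseteq> int (cl A) \<subseteq> int (cl R) = R\<close>, and \<open>int F\<close> is the
  required \<open>(\<sigma>,\<tau>)\<^bsub>\<alpha>\<^esub>\<close>-open neighborhood.
\<close>

section \<open>The interpolating topologies\<close>

lemma interp_open_zero: "interp_open \<sigma> \<tau> {} = {U. openin \<sigma> U}"
  by (subst interp_open.simps) simp

lemma topspace_in_interp_open: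
  fixes \<xi> :: "'o rel"
  assumes "topspace \<sigma> = topspace \<tau>" "Well_order \<xi>"
  shows "topspace \<tau> \<in> interp_open \<sigma> \<tau> \<xi>"
proof -
  have zero: "topspace \<tau> \<in> interp_open \<sigma> \<tau> ({} :: 'o rel)"
    unfolding interp_open_zero assms(1)[symmetric] by simp
  show ?thesis
  proof (cases "\<xi> = {}")
    case True
    with zero show ?thesis by simp
  next
    case False
    \<comment> \<open>The empty relation embeds into every well-order, vacuously.\<close>
    have "embed ({} :: 'o rel) \<xi> undefined"
      by (simp add: embed_def)
    moreover have "\<not> bij_betw undefined (Field ({} :: 'o rel)) (Field \<xi>)"
      using False by (auto simp: bij_betw_def Field_def Domain_empty_iff)
    moreover have "Well_order ({} :: 'o rel)"
      by simp
    ultimately have "({} :: 'o rel) <o \<xi>"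
      using assms(2) unfolding ordLess_def embedS_def by blast
    then show ?thesis
      using interp_open_mono[OF assms(1)] zero by blast
  qed
qed

lemma Union_in_interp_open:
  fixes \<xi> :: "'o rel"
  assumes "topspace \<sigma> = topspace \<tau>" "\<And>U. U \<in> \<U> \<Longrightarrow> U \<in> interp_open \<sigma> \<tau> \<xi>"
  shows "\<Union>\<U> \<in> interp_open \<sigma> \<tau> \<xi>"
  using istopology_interp_open[OF assms(1), of \<xi>] assms(2) unfolding istopology_def by blast

lemma interior_in_interp_open:
  fixes \<gamma> \<xi> :: "'o rel"
  assumes "topspace \<sigma> = topspace \<tau>" "\<gamma> <o \<xi>"
    and "F \<subseteq> topspace \<tau>" "topspace \<tau> - F \<in> interp_open \<sigma> \<tau> \<gamma>"
  shows "\<tau> interior_of F \<in> interp_open \<sigma> \<tau> \<xi>"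
proof -
  have "Well_order \<gamma>"
    using assms(2) unfolding ordLess_def by blast
  then have "interp_basic \<sigma> \<tau> \<xi> (topspace \<tau> \<inter> \<tau> interior_of F)"
    using assms by (intro interp_basicI topspace_in_interp_open)
  moreover have "topspace \<tau> \<inter> \<tau> interior_of F = \<tau> interior_of F"
    using interior_of_subset_topspace[of \<tau> F] by blast
  ultimately show ?thesis
    unfolding interp_open_nonempty[OF ordLess_nonempty[OF assms(2)]]
    by (metis arbitrary_union_of_inc)
qed

lemma openin_if_interp_open:
  fixes \<xi> :: "'o rel"
  assumes "\<forall>U. openin \<sigma> U \<longrightarrow> openin \<tau> U"
  shows "U \<in> interp_open \<sigma> \<tau> \<xi> \<Longrightarrow> openin \<tau> U"
  using wf_ordLess
proof (induction \<xi> arbitrary: U rule: wf_induct_rule)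
  case (less \<xi>)
  show ?case
  proof (cases "\<xi> = {}")
    case True
    with less.prems assms show ?thesis
      by (simp add: interp_open_zero)
  next
    case False
    have "openin \<tau> V" if V: "interp_basic \<sigma> \<tau> \<xi> V" for V
    proof -
      obtain \<gamma> :: "'o rel" and U F where
        "\<gamma> <o \<xi>" "U \<in> interp_open \<sigma> \<tau> \<gamma>" "V = U \<inter> \<tau> interior_of F"
        using V unfolding interp_basic_def by blast
      with less.IH show ?thesis by (simp add: openin_Int)
    qed
    with less.prems show ?thesis
      unfolding interp_open_nonempty[OF False] union_of_def by blast
  qed
qed

section \<open>Borel sets modulo meager sets\<close>

text \<open>
  The size of the covering families is controlled by \<open>\<nu>\<close>, not just by \<open>\<kappa>\<close>: when \<open>\<kappa>\<close> is singular, a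
  union of \<open>\<nu> < \<kappa>\<close> sets, each covered by fewer than \<open>\<kappa>\<close> nowhere dense sets, need not be of this kind
  itself, whereas for infinite \<open>\<nu>\<close> the bound \<open>\<nu>\<close> survives unions of size \<open>\<nu>\<close>.  For finite \<open>\<nu>\<close> iterated
  unions outgrow any fixed finite bound, but stay finite, which is enough since \<open>\<kappa>\<close> is infinite.
\<close>

definition small_family :: "'k rel \<Rightarrow> 'b set \<Rightarrow> bool" where
  "small_family \<nu> \<N> \<longleftrightarrow> (if finite (Field \<nu>) then finite \<N> else |\<N>| \<le>o \<nu>)"

definition meager_up_to :: "'k rel \<Rightarrow> 'a topology \<Rightarrow> 'a set \<Rightarrow> bool" where
  "meager_up_to \<nu> \<tau> M \<longleftrightarrow>
     (\<exists>\<N>. small_family \<nu> \<N> \<and> (\<forall>N\<in>\<N>. nowhere_dense_in \<tau> N) \<and> M \<subseteq> \<Union>\<N>)"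

lemma small_family_UN:
  assumes "Card_order \<nu>" "|I| \<le>o \<nu>" "\<And>i. i \<in> I \<Longrightarrow> small_family \<nu> (\<N> i)"
  shows "small_family \<nu> (\<Union>i\<in>I. \<N> i)"
proof (cases "finite (Field \<nu>)")
  case True
  have "|I| \<le>o |Field \<nu>|"
    using assms(1,2) card_of_Field_ordIso ordIso_symmetric ordLeq_ordIso_trans by blast
  then have "finite I"
    using True card_of_ordLeq_finite by blast
  with True assms(3) show ?thesis
    by (simp add: small_family_def)
next
  case False
  with assms show ?thesis
    by (simp add: small_family_def card_of_UNION_ordLeq_infinite_Field)
qed

lemma small_family_insert:
  assumes "Card_order \<nu>" "small_family \<nu> \<N>"
  shows "small_family \<nu> (insert N \<N>)"
proof (cases "finite (Field \<nu>)")
  case True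
  with assms show ?thesis by (simp add: small_family_def)
next
  case False
  have "|{N}| \<le>o |Field \<nu>|"
    by (rule ordLess_imp_ordLeq, rule finite_ordLess_infinite)
      (simp_all add: card_of_well_order_on Field_card_of False)
  then have "|{N}| \<le>o \<nu>"
    using assms(1) card_of_Field_ordIso ordLeq_ordIso_trans by blast
  then have "|{N} \<union> \<N>| \<le>o \<nu>"
    using False assms by (intro card_of_Un_ordLeq_infinite_Field) (simp_all add: small_family_def)
  with False show ?thesis by (simp add: small_family_def)
qed

lemma small_family_ordLess:
  assumes "Cinfinite \<kappa>" "\<nu> <o \<kappa>" "small_family \<nu> \<N>"
  shows "|\<N>| <o \<kappa>"
proof (cases "finite (Field \<nu>)")
  case True
  with assms(3) have "finite \<N>" by (simp add: small_family_def)
  moreover have "Well_order \<kappa>" "\<not> finite (Field \<kappa>)"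
    using assms(1) by (auto simp: cinfinite_def card_order_on_def)
  ultimately show ?thesis
    by (intro finite_ordLess_infinite) (simp_all add: card_of_well_order_on Field_card_of)
next
  case False
  with assms show ?thesis
    by (simp add: small_family_def) (metis ordLeq_ordLess_trans)
qed

lemma meager_up_to_subset:
  "meager_up_to \<nu> \<tau> M \<Longrightarrow> M' \<subseteq> M \<Longrightarrow> meager_up_to \<nu> \<tau> M'"
  unfolding meager_up_to_def by blast

lemma meager_up_to_empty: "Card_order \<nu> \<Longrightarrow> meager_up_to \<nu> \<tau> {}"
  unfolding meager_up_to_def small_family_def
  by (intro exI[of _ "{}"]) (simp add: card_of_empty1 card_order_on_well_order_on)

lemma meager_up_to_Un_nowhere_dense:
  assumes "Card_order \<nu>" "meager_up_to \<nu> \<tau> M" "nowhere_dense_in \<tau> N"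
  shows "meager_up_to \<nu> \<tau> (M \<union> N)"
proof -
  obtain \<N> where "small_family \<nu> \<N>" "\<forall>N\<in>\<N>. nowhere_dense_in \<tau> N" "M \<subseteq> \<Union>\<N>"
    using assms(2) unfolding meager_up_to_def by blast
  with assms show ?thesis
    unfolding meager_up_to_def
    by (intro exI[of _ "insert N \<N>"]) (auto simp: small_family_insert)
qed

lemma meager_up_to_UN:
  assumes "Card_order \<nu>" "|I| \<le>o \<nu>" "\<And>i. i \<in> I \<Longrightarrow> meager_up_to \<nu> \<tau> (M i)"
  shows "meager_up_to \<nu> \<tau> (\<Union>i\<in>I. M i)"
proof -
  obtain \<N> where N: "\<forall>i\<in>I. small_family \<nu> (\<N> i) \<and> (\<forall>N\<in>\<N> i. nowhere_dense_in \<tau> N) \<and> M i \<subseteq> \<Union>(\<N> i)"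
    using assms(3) unfolding meager_up_to_def by metis
  with assms(1,2) have "small_family \<nu> (\<Union>i\<in>I. \<N> i)"
    by (intro small_family_UN) auto
  moreover have "\<forall>N\<in>(\<Union>i\<in>I. \<N> i). nowhere_dense_in \<tau> N"
    using N by simp
  moreover have "(\<Union>i\<in>I. M i) \<subseteq> \<Union>(\<Union>i\<in>I. \<N> i)"
    using N by (simp add: UN_subset_iff) (metis UN_upper Union_mono subset_trans)
  ultimately show ?thesis
    unfolding meager_up_to_def by (intro exI[of _ "\<Union>i\<in>I. \<N> i"] conjI)
qed

lemma nowhere_dense_closed_minus_interior:
  assumes "closedin \<tau> F"
  shows "nowhere_dense_in \<tau> (F - \<tau> interior_of F)"
proof -
  have "closedin \<tau> (F - \<tau> interior_of F)"
    using assms by (simp add: closedin_diff)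
  moreover have "\<tau> interior_of (F - \<tau> interior_of F) = {}"
  proof -
    have "\<tau> interior_of (F - \<tau> interior_of F) \<subseteq> \<tau> interior_of F"
      by (rule interior_of_mono) simp
    moreover have "\<tau> interior_of (F - \<tau> interior_of F) \<subseteq> F - \<tau> interior_of F"
      by (rule interior_of_subset)
    ultimately show ?thesis by auto
  qed
  ultimately show ?thesis
    by (simp add: nowhere_dense_in_def closure_of_closedin closedin_subset)
qed

lemma open_meager_up_to_empty:
  assumes "Cinfinite \<kappa>" "kappa_Baire \<kappa> \<tau>" "\<nu> <o \<kappa>"
    and "openin \<tau> W" "meager_up_to \<nu> \<tau> W"
  shows "W = {}"
proof -
  obtain \<N> where N: "small_family \<nu> \<N>" "\<forall>N\<in>\<N>. nowhere_dense_in \<tau> N" "W \<subseteq> \<Union>\<N>"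
    using assms(5) unfolding meager_up_to_def by blast
  have "kappa_meager \<kappa> \<tau> (\<Union>\<N>)"
    using N small_family_ordLess[OF assms(1,3) N(1)] unfolding kappa_meager_def by blast
  then have "\<tau> closure_of (topspace \<tau> - \<Union>\<N>) = topspace \<tau>"
    using assms(2) unfolding kappa_Baire_def by blast
  moreover have "W \<inter> (topspace \<tau> - \<Union>\<N>) = {}"
    using N(3) by blast
  ultimately show ?thesis
    using assms(4) openin_Int_closure_of_eq_empty[OF assms(4)] openin_subset[OF assms(4)]
    by (metis inf.absorb_iff1)
qed

lemma borel_P_zero: "borel_P \<sigma> \<nu> {} = {C. closedin \<sigma> C}"
  by (subst borel_P.simps) simp

lemma borel_P_nonzero:
  fixes \<xi> :: "'o rel"
  assumes "\<xi> \<noteq> {}"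
  shows "borel_P \<sigma> \<nu> \<xi> = {topspace \<sigma> \<inter> \<Inter>\<F> |\<F>. |\<F>| \<le>o \<nu> \<and>
    \<F> \<subseteq> (\<lambda>A. topspace \<sigma> - A) ` (\<Union>\<gamma>\<in>{\<gamma> :: 'o rel. \<gamma> <o \<xi>}. borel_P \<sigma> \<nu> \<gamma>)}"
  using assms by (subst borel_P.simps) (simp only: if_False)

lemma borel_P_subset_topspace: "A \<in> borel_P \<sigma> \<nu> \<xi> \<Longrightarrow> A \<subseteq> topspace \<sigma>"
  by (cases "\<xi> = {}") (auto simp: borel_P_zero borel_P_nonzero dest: closedin_subset)

text \<open>
  In the inductive step the complement of \<open>A\<close> is a union of sets of lower classes \<open>\<gamma>\<close>.  Replacing the
  closed approximation of each by its \<open>\<tau>\<close>-interior costs one nowhere dense set and one step in the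
  hierarchy of topologies; the latter is matched by the step from \<open>\<gamma>\<close> to \<open>\<xi>\<close> in the Borel hierarchy.
\<close>

lemma borel_P_eq_interp_closed_mod_meager:
  fixes \<xi> :: "'o rel"
  assumes space: "topspace \<sigma> = topspace \<tau>"
    and finer: "\<forall>U. openin \<sigma> U \<longrightarrow> openin \<tau> U"
    and \<nu>: "Card_order \<nu>"
    and "A \<in> borel_P \<sigma> \<nu> \<xi>"
  shows "\<exists>F \<subseteq> topspace \<tau>. topspace \<tau> - F \<in> interp_open \<sigma> \<tau> \<xi> \<and> meager_up_to \<nu> \<tau> (sym_diff A F)"
  using wf_ordLess assms(4)
proof (induction \<xi> arbitrary: A rule: wf_induct_rule)
  case (less \<xi>)
  show ?case
  proof (cases "\<xi> = {}")
    case True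
    then have "closedin \<sigma> A"
      using less.prems by (simp add: borel_P_zero)
    then have "A \<subseteq> topspace \<tau>" "topspace \<tau> - A \<in> interp_open \<sigma> \<tau> \<xi>"
      using True space by (auto simp: interp_open_zero closedin_def)
    then show ?thesis
      using meager_up_to_empty[OF \<nu>] by (intro exI[of _ A]) simp
  next
    case False
    obtain \<F> where A: "A = topspace \<tau> \<inter> \<Inter>\<F>" and F: "|\<F>| \<le>o \<nu>"
        "\<F> \<subseteq> (\<lambda>A. topspace \<tau> - A) ` (\<Union>\<gamma>\<in>{\<gamma> :: 'o rel. \<gamma> <o \<xi>}. borel_P \<sigma> \<nu> \<gamma>)"
      using less.prems unfolding borel_P_nonzero[OF False] space by blast
    have "\<exists>(\<gamma> :: 'o rel) K. \<gamma> <o \<xi> \<and> K \<subseteq> topspace \<tau> \<and> topspace \<tau> - K \<in> interp_open \<sigma> \<tau> \<gamma> \<and>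
        meager_up_to \<nu> \<tau> (sym_diff (topspace \<tau> - C) K)" if "C \<in> \<F>" for C
    proof -
      obtain \<gamma> :: "'o rel" and B where B: "\<gamma> <o \<xi>" "B \<in> borel_P \<sigma> \<nu> \<gamma>" "C = topspace \<tau> - B"
        using F(2) \<open>C \<in> \<F>\<close> by blast
      then have "topspace \<tau> - C = B"
        using borel_P_subset_topspace[OF B(2)] space by blast
      with B less.IH[OF B(1,2)] show ?thesis by metis
    qed
    then obtain \<gamma> :: "'a set \<Rightarrow> 'o rel" and K where K: "\<And>C. C \<in> \<F> \<Longrightarrow> \<gamma> C <o \<xi> \<and> K C \<subseteq> topspace \<tau> \<and>
        topspace \<tau> - K C \<in> interp_open \<sigma> \<tau> (\<gamma> C) \<and>
        meager_up_to \<nu> \<tau> (sym_diff (topspace \<tau> - C) (K C))"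
      by metis
    define O' where "O' = (\<Union>C\<in>\<F>. \<tau> interior_of K C)"
    have "O' \<in> interp_open \<sigma> \<tau> \<xi>"
      unfolding O'_def
    proof (rule Union_in_interp_open[OF space])
      fix U assume "U \<in> (\<lambda>C. \<tau> interior_of K C) ` \<F>"
      then obtain C where "C \<in> \<F>" "U = \<tau> interior_of K C" by auto
      with K[of C] show "U \<in> interp_open \<sigma> \<tau> \<xi>"
        using interior_in_interp_open[OF space, of "\<gamma> C" \<xi> "K C"] by simp
    qed
    moreover have "O' \<subseteq> topspace \<tau>"
      unfolding O'_def by (intro UN_least interior_of_subset_topspace)
    ultimately have "topspace \<tau> - (topspace \<tau> - O') \<in> interp_open \<sigma> \<tau> \<xi>"
      by (simp add: double_diff)
    moreover have "meager_up_to \<nu> \<tau> (sym_diff A (topspace \<tau> - O'))"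
    proof (rule meager_up_to_subset)
      show "meager_up_to \<nu> \<tau> (\<Union>C\<in>\<F>. sym_diff (topspace \<tau> - C) (K C) \<union> (K C - \<tau> interior_of K C))"
      proof (rule meager_up_to_UN[OF \<nu> F(1)])
        fix C assume C: "C \<in> \<F>"
        have "openin \<tau> (topspace \<tau> - K C)"
          using K[OF C] by (intro openin_if_interp_open[OF finer, where \<xi> = "\<gamma> C"]) simp
        then have "closedin \<tau> (K C)"
          using K[OF C] by (simp add: closedin_def)
        then show "meager_up_to \<nu> \<tau> (sym_diff (topspace \<tau> - C) (K C) \<union> (K C - \<tau> interior_of K C))"
          using K[OF C]
          by (intro meager_up_to_Un_nowhere_dense[OF \<nu> _ nowhere_dense_closed_minus_interior])
            simp_all
      qed
      show "sym_diff A (topspace \<tau> - O')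
          \<subseteq> (\<Union>C\<in>\<F>. sym_diff (topspace \<tau> - C) (K C) \<union> (K C - \<tau> interior_of K C))"
      proof
        fix x assume "x \<in> sym_diff A (topspace \<tau> - O')"
        then consider "x \<in> A" "x \<in> O'" | "x \<in> topspace \<tau>" "x \<notin> O'" "x \<notin> A"
          unfolding A by blast
        then show "x \<in> (\<Union>C\<in>\<F>. sym_diff (topspace \<tau> - C) (K C) \<union> (K C - \<tau> interior_of K C))"
        proof cases
          case 1
          then obtain C where C: "C \<in> \<F>" "x \<in> \<tau> interior_of K C" "x \<in> C"
            unfolding A O'_def by auto
          then have "x \<in> K C"
            using interior_of_subset[of \<tau> "K C"] by auto
          with C show ?thesis by (intro UN_I[of C]) simp_all
        next
          case 2
          then obtain C where "C \<in> \<F>" "x \<notin> C" "x \<in> topspace \<tau>" "x \<notin> \<tau> interior_of K C"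
            unfolding A O'_def by auto
          then show ?thesis by (intro UN_I[of C]) simp_all
        qed
      qed
    qed
    ultimately show ?thesis by (intro exI[of _ "topspace \<tau> - O'"]) simp
  qed
qed

section \<open>Recovering the finer topology\<close>

text \<open>
  Both inclusions hold because \<open>int A - F\<close> and \<open>int F - cl A\<close> are open and contained in the symmetric
  difference of \<open>A\<close> and \<open>F\<close>.
\<close>

lemma interior_between_if_eq_mod_meager:
  assumes "Cinfinite \<kappa>" "kappa_Baire \<kappa> \<tau>" "\<nu> <o \<kappa>"
    and "A \<subseteq> topspace \<tau>" "closedin \<tau> F" "meager_up_to \<nu> \<tau> (sym_diff A F)"
  shows "\<tau> interior_of A \<subseteq> \<tau> interior_of F"
    and "\<tau> interior_of F \<subseteq> \<tau> interior_of (\<tau> closure_of A)"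
proof -
  note empty = open_meager_up_to_empty[OF assms(1-3)]
  have "meager_up_to \<nu> \<tau> (\<tau> interior_of A - F)"
    using interior_of_subset[of \<tau> A] by (intro meager_up_to_subset[OF assms(6)]) blast
  then have "\<tau> interior_of A - F = {}"
    using assms(5) by (intro empty openin_diff) simp_all
  then show "\<tau> interior_of A \<subseteq> \<tau> interior_of F"
    by (intro interior_of_maximal) auto
  have "meager_up_to \<nu> \<tau> (\<tau> interior_of F - \<tau> closure_of A)"
    using interior_of_subset[of \<tau> F] closure_of_subset[OF assms(4)]
    by (intro meager_up_to_subset[OF assms(6)]) blast
  then have "\<tau> interior_of F - \<tau> closure_of A = {}"
    by (intro empty openin_diff) simp_all
  then show "\<tau> interior_of F \<subseteq> \<tau> interior_of (\<tau> closure_of A)"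
    by (intro interior_of_maximal) auto
qed

lemma regular_openin_Int:
  assumes "regular_openin \<tau> R" "regular_openin \<tau> S"
  shows "regular_openin \<tau> (R \<inter> S)"
proof -
  have "openin \<tau> R" "openin \<tau> S"
    using assms openin_interior_of[of \<tau> "\<tau> closure_of R"] openin_interior_of[of \<tau> "\<tau> closure_of S"]
    by (simp_all add: regular_openin_def)
  then have "openin \<tau> (R \<inter> S)" by blast
  then have "R \<inter> S \<subseteq> \<tau> interior_of (\<tau> closure_of (R \<inter> S))"
    by (intro interior_of_maximal closure_of_subset) (auto dest: openin_subset)
  moreover
  have "\<tau> interior_of (\<tau> closure_of (R \<inter> S)) \<subseteq> \<tau> interior_of (\<tau> closure_of R)"
      "\<tau> interior_of (\<tau> closure_of (R \<inter> S)) \<subseteq> \<tau> interior_of (\<tau> closure_of S)"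
    by (intro interior_of_mono closure_of_mono; simp)+
  then have "\<tau> interior_of (\<tau> closure_of (R \<inter> S)) \<subseteq> R \<inter> S"
    using assms by (simp add: regular_openin_def)
  ultimately show ?thesis
    unfolding regular_openin_def by (intro subset_antisym)
qed

text \<open>The regular open sets, a priori only a subbase, form a base, being closed under intersection.\<close>

lemma semiregular_regular_open_between:
  assumes "semiregular \<tau>" "openin \<tau> B" "x \<in> B"
  obtains R where "regular_openin \<tau> R" "x \<in> R" "R \<subseteq> B"
proof -
  have "openin (topology_generated_by {U. regular_openin \<tau> U}) B"
    using assms(1,2) by (simp add: semiregular_def)
  then have "generate_topology_on {U. regular_openin \<tau> U} B"
    by (rule openin_topology_generated_by)
  then have "\<forall>x\<in>B. \<exists>R. regular_openin \<tau> R \<and> x \<in> R \<and> R \<subseteq> B"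
  proof induction
    case Empty
    show ?case by simp
  next
    case (Int a b)
    show ?case
    proof
      fix x assume x: "x \<in> a \<inter> b"
      obtain R where R: "regular_openin \<tau> R" "x \<in> R" "R \<subseteq> a"
        using Int.IH(1) x by auto
      obtain S where S: "regular_openin \<tau> S" "x \<in> S" "S \<subseteq> b"
        using Int.IH(2) x by auto
      from R S show "\<exists>R. regular_openin \<tau> R \<and> x \<in> R \<and> R \<subseteq> a \<inter> b"
        by (intro exI[of _ "R \<inter> S"]) (simp add: regular_openin_Int le_infI1 le_infI2)
    qed
  next
    case (UN K)
    show ?case
    proof
      fix x assume "x \<in> \<Union>K"
      then obtain k where k: "k \<in> K" "x \<in> k" by auto
      then obtain R where "regular_openin \<tau> R" "x \<in> R" "R \<subseteq> k"
        using UN.IH[OF k(1)] by auto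
      with k(1) show "\<exists>R. regular_openin \<tau> R \<and> x \<in> R \<and> R \<subseteq> \<Union>K"
        by (intro exI[of _ R]) (simp add: Sup_upper2)
    qed
  next
    case (Basis s)
    then show ?case by auto
  qed
  then obtain R where "regular_openin \<tau> R" "x \<in> R" "R \<subseteq> B"
    using assms(3) by auto
  then show ?thesis by (rule that)
qed

theorem corollary3p5:
  fixes X :: "'a set"
    and \<sigma> \<tau> :: "'a topology"
    and \<kappa> :: "'k rel"
    and \<alpha> :: "'o rel"
    and \<A> :: "'a set set"
  assumes "topspace \<sigma> = X" and "topspace \<tau> = X"
    and "\<And>U. openin \<sigma> U \<Longrightarrow> openin \<tau> U"
    and "semiregular \<tau>"
    and "Cinfinite \<kappa>"
    and "kappa_Baire \<kappa> \<tau>"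
    and "Well_order \<alpha>" and "\<alpha> \<noteq> {}" and "\<alpha> \<le>o \<kappa>"
    and "nhd_basis \<tau> \<A>"
    and "\<A> \<subseteq> (\<Union>\<xi>\<in>{\<xi> :: 'o rel. \<xi> <o \<alpha>}. borel_Pi \<sigma> \<kappa> \<xi>)"
  shows "\<tau> = interp_topology \<sigma> \<tau> \<alpha>"
proof -
  have space: "topspace \<sigma> = topspace \<tau>"
    using assms(1,2) by simp
  have finer: "\<forall>U. openin \<sigma> U \<longrightarrow> openin \<tau> U"
    using assms(3) by blast
  have local: "\<exists>V \<in> interp_open \<sigma> \<tau> \<alpha>. x \<in> V \<and> V \<subseteq> B" if B: "openin \<tau> B" "x \<in> B" for B x
  proof -
    obtain R where R: "regular_openin \<tau> R" "x \<in> R" "R \<subseteq> B"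
      using semiregular_regular_open_between[OF assms(4) B] .
    have "openin \<tau> R"
      using R(1) openin_interior_of[of \<tau> "\<tau> closure_of R"] by (simp add: regular_openin_def)
    then have "\<exists>A\<in>\<A>. x \<in> \<tau> interior_of A \<and> A \<subseteq> R"
      using assms(10) R(2) unfolding nhd_basis_def by simp
    then obtain A where A: "A \<in> \<A>" "x \<in> \<tau> interior_of A" "A \<subseteq> R" by auto
    have A_sub: "A \<subseteq> topspace \<tau>"
      using assms(10) A(1) unfolding nhd_basis_def by simp
    obtain \<xi> :: "'o rel" where \<xi>: "\<xi> <o \<alpha>" "A \<in> borel_Pi \<sigma> \<kappa> \<xi>"
      using subsetD[OF assms(11) A(1)] by auto
    then obtain \<nu> :: "'k rel" where \<nu>: "Card_order \<nu>" "\<nu> <o \<kappa>" "A \<in> borel_P \<sigma> \<nu> \<xi>"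
      unfolding borel_Pi_def by auto
    obtain F where F: "F \<subseteq> topspace \<tau>" "topspace \<tau> - F \<in> interp_open \<sigma> \<tau> \<xi>"
        "meager_up_to \<nu> \<tau> (sym_diff A F)"
      using borel_P_eq_interp_closed_mod_meager[OF space finer \<nu>(1,3)] by blast
    have "closedin \<tau> F"
      using F(1) openin_if_interp_open[OF finer F(2)] by (simp add: closedin_def)
    note between = interior_between_if_eq_mod_meager[OF assms(5,6) \<nu>(2) A_sub this F(3)]
    have "\<tau> interior_of (\<tau> closure_of A) \<subseteq> \<tau> interior_of (\<tau> closure_of R)"
      using A(3) by (intro interior_of_mono closure_of_mono)
    also have "\<dots> = R"
      using R(1) unfolding regular_openin_def .
    finally have "\<tau> interior_of F \<subseteq> B"
      using between(2) R(3) by blast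
    moreover have "x \<in> \<tau> interior_of F"
      using between(1) A(2) by (rule subsetD)
    ultimately show ?thesis
      using interior_in_interp_open[OF space \<xi>(1) F(1,2)] by (intro bexI[of _ "\<tau> interior_of F"]) simp_all
  qed
  have "openin \<tau> B \<longleftrightarrow> B \<in> interp_open \<sigma> \<tau> \<alpha>" for B
  proof
    assume B: "openin \<tau> B"
    have "B = \<Union>{V \<in> interp_open \<sigma> \<tau> \<alpha>. V \<subseteq> B}"
    proof
      show "B \<subseteq> \<Union>{V \<in> interp_open \<sigma> \<tau> \<alpha>. V \<subseteq> B}"
        using local[OF B] by auto
    qed auto
    also have "\<dots> \<in> interp_open \<sigma> \<tau> \<alpha>"
      by (rule Union_in_interp_open[OF space]) simp
    finally show "B \<in> interp_open \<sigma> \<tau> \<alpha>" .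
  qed (rule openin_if_interp_open[OF finer])
  then show ?thesis
    by (simp add: topology_eq openin_interp_topology[OF space])
qed

end
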